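(* Suppose that $Y_1,\ldots,Y_n$ are independent and identically distributed from a continuous distribution. Fix the interval-sampling scheme and the number of sampled intervals $M$. Then the null distribution of $T^{\mathrm{WBS}}_{1,n}$ (its distribution under this i.i.d. assumption) depends only on $n$, $M$, and the interval-sampling scheme, and not on the common distribution of the observations. Consequently, if $\gamma_\alpha(n)$ is the $(1-\alpha)$ quantile of this null distribution, then $$\Pr\{T^{\mathrm{WBS}}_{1,n}>\gamma_\alpha(n)\}\le \alpha .$$ Under the global no-change null (that is, $Y_1,\ldots,Y_n$ i.i.d. from a continuous distribution), the probability that the WBS-Lepage procedure detects at least one change point is therefore at most $\alpha$, up to Monte Carlo error in the approximation of $\gamma_\alpha(n)$.
   Context: Statistic. Let $y_1,\ldots,y_n$ be real observations. For integers $1\le p\le k<q\le n$ put $\ell=q-p+1$, $n_1=k-p+1$, $n_2=q-k$. For $i=p,\ldots,q$ let $r_i^{p,q}=\sum_{j=p}^q I(y_i\ge y_j)$ be the rank of $y_i$ among $y_p,\ldots,y_q$. Define $$U^k_{p,q}=\sum_{i=p}^k r_i^{p,q}-\frac{n_1(n_1+1)}{2},\qquad M^k_{p,q}=\sum_{i=p}^k\Big(r_i^{p,q}-\frac{\ell+1}{2}\Big)^2,$$ and the Lepage-type statistic $$L^k_{p,q}=\frac{\big(U^k_{p,q}-\frac{n_1n_2}{2}\big)^2}{n_1n_2(\ell+1)/12}+\frac{\big(M^k_{p,q}-\frac{n_1(\ell^2-1)}{12}\big)^2}{n_1n_2(\ell+1)(\ell^2-4)/180}.$$ For an integer interval $[s,e]$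 let $T_{s,e}=\max_{s\le k<e}L^k_{s,e}$. Interval-sampling scheme. An interval-sampling scheme is a rule which, for a segment $[p,q]$ and a number $M$, generates at random, independently of the data, a collection $\mathcal F^M_{p,q}$ of $M$ integer intervals $[s_m,e_m]$ with $p\le s_m<e_m\le q$; only intervals of length $e_m-s_m+1$ at least 10 are used, so segments have length at least 10 (in particular $n\ge 10$). The WBS-Lepage statistic is $$T^{\mathrm{WBS}}_{p,q}=\max_{[s_m,e_m]\in\mathcal F^M_{p,q}}T_{s_m,e_m}.$$ Thresholds. The number $\alpha\in(0,1)$ is the significance level. The procedure uses a threshold function $\gamma(\cdot)$ of the segment length, where $\gamma(n)$ is chosen as the $(1-\alpha)$ quantile $\gamma_\alpha(n)$ of the null distribution of $T^{\mathrm{WBS}}_{1,n}$. In practice it is approximated by Monte Carlo: i.i.d. sequences are simulated, $T^{\mathrm{WBS}}_{1,n}$ is computed for each with the same interval-sampling scheme and the same $M$, and the empirical percentile is used. "Monte Carlo error" refers to the error of this approximation of $\gamma_\alpha(n)$. WBS-Lepage procedure. Define a recursive procedure WBS-LP$(p,q)$: if $q-p+1<10$, return $\varnothing$. Otherwise generate new random intervals $\mathcal F^M_{p,q}$ and compute $T^{\mathrm{WBS}}_{p,q}$. If $T^{\mathrm{WBS}}_{p,q}>\gamma(q-p+1)$, let $[s_0,e_0]$ be an interval in $\mathcal F^M_{p,q}$ maximizing $T_{s_m,e_m}$, let $\tilde k$ be a maximizer of $L^k_{s_0,e_0}$ over $s_0\le k<e_0$, and return WBS-LP$(p,\tilde k)\cup\{\tilde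 k\}\cup$ WBS-LP$(\tilde k+1,q)$; otherwise return $\varnothing$. The procedure computes WBS-LP$(1,n)$ and then prunes: writing the candidates as $\hat\tau_1<\cdots<\hat\tau_{\hat K}$ with $\hat\tau_0=0$, $\hat\tau_{\hat K+1}=n$, for each $j$ it sets $a_j=\hat\tau_{j-1}+1$, $b_j=\hat\tau_{j+1}$, computes $T^{\mathrm{WBS}}_{a_j,b_j}$ with $M$ random intervals contained in $[a_j,b_j]$, and removes $\hat\tau_j$ if this does not exceed $\gamma(b_j-a_j+1)$. Pruning can only remove candidates and never adds any. The pruned set is the set of detected change points. *)

theory Defs
  imports "HOL-Probability.Probability"
begin

type_synonym interval = "nat \<times> nat"

definition seg_rank :: "(nat \<Rightarrow> real) \<Rightarrow> nat \<Rightarrow> nat \<Rightarrow> nat \<Rightarrow> real" where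
  "seg_rank y p q i = (\<Sum>j=p..q. of_bool (y i \<ge> y j))"

definition U_stat :: "(nat \<Rightarrow> real) \<Rightarrow> nat \<Rightarrow> nat \<Rightarrow> nat \<Rightarrow> real" where
  "U_stat y p q k =
     (let n1 = real (k - p + 1) in (\<Sum>i=p..k. seg_rank y p q i) - n1 * (n1 + 1) / 2)"

definition M_stat :: "(nat \<Rightarrow> real) \<Rightarrow> nat \<Rightarrow> nat \<Rightarrow> nat \<Rightarrow> real" where
  "M_stat y p q k =
     (let l = real (q - p + 1) in (\<Sum>i=p..k. (seg_rank y p q i - (l + 1) / 2)\<^sup>2))"

definition lepage :: "(nat \<Rightarrow> real) \<Rightarrow> nat \<Rightarrow> nat \<Rightarrow> nat \<Rightarrow> real" where
  "lepage y p q k =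
     (let l = real (q - p + 1); n1 = real (k - p + 1); n2 = real (q - k) in
        (U_stat y p q k - n1 * n2 / 2)\<^sup>2 / (n1 * n2 * (l + 1) / 12)
      + (M_stat y p q k - n1 * (l\<^sup>2 - 1) / 12)\<^sup>2 / (n1 * n2 * (l + 1) * (l\<^sup>2 - 4) / 180))"

definition interval_stat :: "(nat \<Rightarrow> real) \<Rightarrow> interval \<Rightarrow> real" where
  "interval_stat y = (\<lambda>(s, e). Max (lepage y s e ` {s..<e}))"

definition wbs_stat :: "(nat \<Rightarrow> real) \<Rightarrow> interval list \<Rightarrow> real" where
  "wbs_stat y Fs = Max (interval_stat y ` set Fs)"

definition interval_collections :: "nat \<Rightarrow> nat \<Rightarrow> nat \<Rightarrow> interval list set" where
  "interval_collections p q m =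
     {Fs. length Fs = m \<and> (\<forall>(s, e)\<in>set Fs. p \<le> s \<and> s < e \<and> e \<le> q \<and> 10 \<le> e - s + 1)}"

definition segments :: "nat \<Rightarrow> interval set" where
  "segments n = {(p, q). 1 \<le> p \<and> p \<le> q \<and> q \<le> n \<and> 10 \<le> q - p + 1}"

text \<open>A scheme gives the law of the collection of \<open>m\<close> intervals drawn in the segment \<open>[p, q]\<close>.
  A segment contains only finitely many intervals, so a \<open>pmf\<close> is no loss of generality.
  Repeated intervals are allowed.\<close>

definition interval_scheme :: "(nat \<Rightarrow> nat \<Rightarrow> nat \<Rightarrow> interval list pmf) \<Rightarrow> bool" where
  "interval_scheme S \<longleftrightarrow>
     (\<forall>n m. \<forall>(p, q)\<in>segments n. set_pmf (S p q m) \<subseteq> interval_collections p q m)"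

definition maximizers :: "('b \<Rightarrow> real) \<Rightarrow> 'b list \<Rightarrow> 'b list" where
  "maximizers f xs = filter (\<lambda>x. \<forall>x'\<in>set xs. f x' \<le> f x) xs"

text \<open>The procedure may use any maximizing interval and any maximizing split point.  The choice is
  made by tie-breaking rules, which select an element of the list of all maximizers;
  \<open>hd\<close> is an example.\<close>

definition tie_breaker :: "('b list \<Rightarrow> 'b) \<Rightarrow> bool" where
  "tie_breaker c \<longleftrightarrow> (\<forall>xs. xs \<noteq> [] \<longrightarrow> c xs \<in> set xs)"

definition split_point ::
  "(interval list \<Rightarrow> interval) \<Rightarrow> (nat list \<Rightarrow> nat) \<Rightarrow> (nat \<Rightarrow> real) \<Rightarrow> interval list \<Rightarrow> nat" where
  "split_point cI cK y Fs =
     (let (s, e) = cI (maximizers (interval_stat y) Fs)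
      in cK (maximizers (lepage y s e) [s..<e]))"

text \<open>\<open>F (p, q)\<close> is the collection drawn by the call on \<open>[p, q]\<close>.  No segment is visited twice in a
  run, so indexing the draws by segments amounts to a new draw in every call.  The condition
  \<open>k \<in> {p..<q}\<close> only serves termination: it always holds if \<open>F (p, q)\<close> is a nonempty collection of
  intervals in \<open>[p, q]\<close> and \<open>cI\<close>, \<open>cK\<close> are tie-breaking rules.\<close>

function wbs_lp ::
  "(interval list \<Rightarrow> interval) \<Rightarrow> (nat list \<Rightarrow> nat) \<Rightarrow> (nat \<Rightarrow> real) \<Rightarrow> (nat \<Rightarrow> real) \<Rightarrow>
   (interval \<Rightarrow> interval list) \<Rightarrow> nat \<Rightarrow> nat \<Rightarrow> nat set" where
  "wbs_lp cI cK \<gamma> y F p q =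
     (if q + 1 < p + 10 then {}
      else let k = split_point cI cK y (F (p, q)) in
        if wbs_stat y (F (p, q)) > \<gamma> (q - p + 1) \<and> k \<in> {p..<q}
        then wbs_lp cI cK \<gamma> y F p k \<union> {k} \<union> wbs_lp cI cK \<gamma> y F (k + 1) q
        else {})"
  by pat_completeness auto
termination
  by (relation "Wellfounded.measure (\<lambda>(_, _, _, _, _, p, q). q + 1 - p)") auto

declare wbs_lp.simps [simp del]

text \<open>Neighbouring candidates can be so close that \<open>[a, b]\<close> has length less than 10 and contains no
  admissible interval, so that the pruning test cannot be carried out; \<open>keep\<close> says whether
  such a candidate is kept.\<close>

definition prune ::
  "bool \<Rightarrow> (nat \<Rightarrow> real) \<Rightarrow> nat \<Rightarrow> (nat \<Rightarrow> real) \<Rightarrow> (interval \<Rightarrow> interval list) \<Rightarrow> nat set \<Rightarrow> nat set" where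
  "prune keep \<gamma> n y G C =
     {t \<in> C. let a = Max (insert 0 {c \<in> C. c < t}) + 1;
                b = Min (insert n {c \<in> C. t < c})
            in if b + 1 < a + 10 then keep else wbs_stat y (G (a, b)) > \<gamma> (b - a + 1)}"

definition wbs_lepage ::
  "(interval list \<Rightarrow> interval) \<Rightarrow> (nat list \<Rightarrow> nat) \<Rightarrow> bool \<Rightarrow> (nat \<Rightarrow> real) \<Rightarrow> nat \<Rightarrow> (nat \<Rightarrow> real) \<Rightarrow>
   (interval \<Rightarrow> interval list) \<Rightarrow> (interval \<Rightarrow> interval list) \<Rightarrow> nat set" where
  "wbs_lepage cI cK keep \<gamma> n y F G = prune keep \<gamma> n y G (wbs_lp cI cK \<gamma> y F 1 n)"

text \<open>Joint independence of the real random variables \<open>Z i\<close> (\<open>i \<in> A\<close>) and the random interval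
  collections \<open>K j\<close> (\<open>j \<in> B\<close>).  The constant \<open>indep_vars\<close> requires a common value type, so
  this uses the generated sigma-algebras, as in \<open>indep_vars_def2\<close>.\<close>

definition indep_sources ::
  "'a measure \<Rightarrow> ('i \<Rightarrow> 'a \<Rightarrow> real) \<Rightarrow> 'i set \<Rightarrow> ('j \<Rightarrow> 'a \<Rightarrow> interval list) \<Rightarrow> 'j set \<Rightarrow> bool" where
  "indep_sources \<Omega> Z A K B \<longleftrightarrow>
     prob_space.indep_sets \<Omega>
       (case_sum (\<lambda>i. {Z i -` E \<inter> space \<Omega> |E. E \<in> sets borel})
                 (\<lambda>j. {K j -` E \<inter> space \<Omega> |E. E \<in> sets (count_space UNIV)}))
       (A <+> B)"

definition continuous_distribution :: "real measure \<Rightarrow> bool" where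
  "continuous_distribution D \<longleftrightarrow> real_distribution D \<and> continuous_on UNIV (cdf D)"

text \<open>The collection is admissible for every outcome, not just almost surely, so that the statistics
  only ever involve observations inside \<open>[p, q]\<close>.\<close>

definition scheme_draw ::
  "'a measure \<Rightarrow> (nat \<Rightarrow> nat \<Rightarrow> nat \<Rightarrow> interval list pmf) \<Rightarrow> nat \<Rightarrow> interval \<Rightarrow>
   ('a \<Rightarrow> interval list) \<Rightarrow> bool" where
  "scheme_draw \<Omega> S m = (\<lambda>(p, q) C.
     C \<in> measurable \<Omega> (count_space UNIV) \<and>
     (\<forall>\<omega>\<in>space \<Omega>. C \<omega> \<in> interval_collections p q m) \<and>
     distr \<Omega> (count_space UNIV) C = measure_pmf (S p q m))"

locale null_data = prob_space \<Omega> for \<Omega> :: "'a measure" +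
  fixes D :: "real measure" and n :: nat and Y :: "nat \<Rightarrow> 'a \<Rightarrow> real"
  assumes continuous_D: "continuous_distribution D"
    and Y_rv: "i \<in> {1..n} \<Longrightarrow> random_variable borel (Y i)"
    and Y_distr: "i \<in> {1..n} \<Longrightarrow> distr \<Omega> borel (Y i) = D"

locale null_sample = null_data \<Omega> D n Y
  for \<Omega> :: "'a measure" and D n Y +
  fixes S :: "nat \<Rightarrow> nat \<Rightarrow> nat \<Rightarrow> interval list pmf" and m :: nat and C :: "'a \<Rightarrow> interval list"
  assumes C_draw: "scheme_draw \<Omega> S m (1, n) C"
    and indep: "indep_sources \<Omega> Y {1..n} (\<lambda>_::unit. C) UNIV"

text \<open>A run of the procedure: \<open>F\<close> are the draws of the recursion, \<open>G\<close> those of the pruning step.\<close>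

locale null_run = null_data \<Omega> D n Y
  for \<Omega> :: "'a measure" and D n Y +
  fixes S :: "nat \<Rightarrow> nat \<Rightarrow> nat \<Rightarrow> interval list pmf" and m :: nat
    and F G :: "interval \<Rightarrow> 'a \<Rightarrow> interval list"
  assumes F_draw: "s \<in> segments n \<Longrightarrow> scheme_draw \<Omega> S m s (F s)"
    and G_draw: "s \<in> segments n \<Longrightarrow> scheme_draw \<Omega> S m s (G s)"
    and indep: "indep_sources \<Omega> Y {1..n} (case_sum F G) (segments n <+> segments n)"

text \<open>A run together with \<open>N\<close> independent Monte Carlo replications of length \<open>n\<close>: replication \<open>r\<close>
  consists of the simulated observations \<open>X (r, i)\<close>, drawn from a continuous distribution \<open>D\<^sub>s\<close>
  that may differ from that of the data, and of the interval collection \<open>H r\<close>.\<close>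

locale monte_carlo_run = null_run \<Omega> D n Y S m F G
  for \<Omega> :: "'a measure" and D n Y S m F G +
  fixes D\<^sub>s :: "real measure" and N :: nat
    and X :: "nat \<times> nat \<Rightarrow> 'a \<Rightarrow> real" and H :: "nat \<Rightarrow> 'a \<Rightarrow> interval list"
  assumes N_pos: "0 < N"
    and X_data: "r < N \<Longrightarrow> null_data \<Omega> D\<^sub>s n (\<lambda>i. X (r, i))"
    and H_draw: "r < N \<Longrightarrow> scheme_draw \<Omega> S m (1, n) (H r)"
    and joint_indep: "indep_sources \<Omega>
          (case_sum Y X) ({1..n} <+> {..<N} \<times> {1..n})
          (case_sum (case_sum F G) H) ((segments n <+> segments n) <+> {..<N})"

definition wbs_law ::
  "'a measure \<Rightarrow> (nat \<Rightarrow> 'a \<Rightarrow> real) \<Rightarrow> ('a \<Rightarrow> interval list) \<Rightarrow> real measure" where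
  "wbs_law \<Omega> Y C = distr \<Omega> borel (\<lambda>\<omega>. wbs_stat (\<lambda>i. Y i \<omega>) (C \<omega>))"

definition quantile :: "real measure \<Rightarrow> real \<Rightarrow> real" where
  "quantile P u = Inf {x. u \<le> cdf P x}"

definition empirical_quantile :: "nat \<Rightarrow> (nat \<Rightarrow> real) \<Rightarrow> real \<Rightarrow> real" where
  "empirical_quantile N t u = Inf {x. u \<le> real (card {r. r < N \<and> t r \<le> x}) / real N}"

definition monte_carlo_threshold ::
  "real \<Rightarrow> nat \<Rightarrow> (nat \<times> nat \<Rightarrow> 'a \<Rightarrow> real) \<Rightarrow> (nat \<Rightarrow> 'a \<Rightarrow> interval list) \<Rightarrow> 'a \<Rightarrow> real" where
  "monte_carlo_threshold \<alpha> N X H \<omega> =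
     empirical_quantile N (\<lambda>r. wbs_stat (\<lambda>i. X (r, i) \<omega>) (H r \<omega>)) (1 - \<alpha>)"

text \<open>The error made by using the random threshold \<open>g\<close> in place of \<open>c\<close>, on the probability scale:
  the expected mass that the law \<open>P\<close> of the statistic puts between the two.\<close>

definition threshold_error :: "'a measure \<Rightarrow> real measure \<Rightarrow> ('a \<Rightarrow> real) \<Rightarrow> real \<Rightarrow> real" where
  "threshold_error \<Omega> P g c = (\<integral>\<omega>. \<bar>cdf P (g \<omega>) - cdf P c\<bar> \<partial>\<Omega>)"

end

theory Submission
  imports Defs
begin

text \<open>The statistic uses the observations only through their order relations.  A continuous
  distribution is the image of the uniform distribution on \<open>(0, 1)\<close> under its quantile function,
  which is strictly increasing there, so replacing uniform observations by the actual ones does not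
  change the statistic, and its law is that of the uniform case.  The procedure
  can only detect something if the very first test, on \<open>[1, n]\<close>, rejects.  A Monte Carlo threshold
  \<open>g\<close> is independent of the statistic of that test, which therefore exceeds \<open>g\<close> with probability
  \<open>\<integral>1 - cdf P (g \<omega>)\<close>.\<close>

section \<open>Order invariance and measurability\<close>

text \<open>The more familiar transform, applying \<open>cdf D\<close> to the observations, is
  constant wherever \<open>D\<close> has no mass, so it preserves order only almost surely. The
  quantile function goes the other way and preserves order at every point of (0, 1), so no
  exceptional null set has to be carried along.

  The other burden is measurability of the detection event, where the collections, the split points
  and the neighbours of a candidate are all random. Each of them takes countably many values, so
  every such argument fixes the value first and then combines countably many events.

  The Monte Carlo bound is stated on the probability scale because independence lets a random
  threshold be treated as fixed: replacing \<open>c\<close> by \<open>g\<close> changes the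
  exceedance probability by at most the difference of the two cdf values.\<close>

lemma interval_collectionsD:
  assumes "Fs \<in> interval_collections p q m" "(s, e) \<in> set Fs"
  shows "p \<le> s" "s < e" "e \<le> q"
  using assms by (auto simp: interval_collections_def)

lemma lepage_order_cong:
  assumes "k \<in> {p..<q}"
    and "\<And>i j. i \<in> {p..q} \<Longrightarrow> j \<in> {p..q} \<Longrightarrow> y i \<le> y j \<longleftrightarrow> z i \<le> z j"
  shows "lepage y p q k = lepage z p q k"
proof -
  have "seg_rank y p q i = seg_rank z p q i" if "i \<in> {p..k}" for i
    using assms that unfolding seg_rank_def by (intro sum.cong) auto
  then show ?thesis
    unfolding lepage_def U_stat_def M_stat_def by simp
qed

lemma wbs_stat_order_cong:
  assumes Fs: "Fs \<in> interval_collections p q m"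
    and yz: "\<And>i j. i \<in> {p..q} \<Longrightarrow> j \<in> {p..q} \<Longrightarrow> y i \<le> y j \<longleftrightarrow> z i \<le> z j"
  shows "wbs_stat y Fs = wbs_stat z Fs"
proof -
  have "interval_stat y (s, e) = interval_stat z (s, e)" if "(s, e) \<in> set Fs" for s e
  proof -
    have "lepage y s e k = lepage z s e k" if "k \<in> {s..<e}" for k
      using interval_collectionsD[OF Fs \<open>(s, e) \<in> set Fs\<close>] yz that
      by (intro lepage_order_cong) auto
    then show ?thesis
      unfolding interval_stat_def prod.case by (intro arg_cong[where f = Max] image_cong) auto
  qed
  then show ?thesis
    unfolding wbs_stat_def by (intro arg_cong[where f = Max] image_cong) auto
qed

lemma measurable_lepage:
  assumes Y: "\<And>i. i \<in> {p..q} \<Longrightarrow> Y i \<in> borel_measurable M" and k: "k \<in> {p..<q}"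
  shows "(\<lambda>\<omega>. lepage (\<lambda>i. Y i \<omega>) p q k) \<in> borel_measurable M"
proof -
  have [measurable]: "(\<lambda>\<omega>. seg_rank (\<lambda>i. Y i \<omega>) p q i) \<in> borel_measurable M" if "i \<in> {p..k}" for i
    unfolding seg_rank_def
  proof (intro borel_measurable_sum)
    fix j assume "j \<in> {p..q}"
    then have [measurable]: "Y j \<in> borel_measurable M" "Y i \<in> borel_measurable M"
      using Y k that by auto
    show "(\<lambda>\<omega>. of_bool (Y j \<omega> \<le> Y i \<omega>) :: real) \<in> borel_measurable M"
      by measurable
  qed
  show ?thesis
    unfolding lepage_def U_stat_def M_stat_def Let_def by measurable
qed

lemma measurable_interval_stat:
  assumes Y: "\<And>i. i \<in> {p..q} \<Longrightarrow> Y i \<in> borel_measurable M"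
    and Fs: "Fs \<in> interval_collections p q m" and I: "I \<in> set Fs"
  shows "(\<lambda>\<omega>. interval_stat (\<lambda>i. Y i \<omega>) I) \<in> borel_measurable M"
proof (cases I)
  case (Pair s e)
  then show ?thesis
    using interval_collectionsD[OF Fs, of s e] I unfolding interval_stat_def prod.case
    by (auto intro!: borel_measurable_Max measurable_lepage Y)
qed

lemma measurable_wbs_stat:
  assumes Y: "\<And>i. i \<in> {p..q} \<Longrightarrow> Y i \<in> borel_measurable M"
    and Fs: "Fs \<in> interval_collections p q m"
  shows "(\<lambda>\<omega>. wbs_stat (\<lambda>i. Y i \<omega>) Fs) \<in> borel_measurable M"
  unfolding wbs_stat_def
proof (intro borel_measurable_Max)
qed (use measurable_interval_stat[OF Y Fs] in auto)

text \<open>A countably valued \<open>C\<close> reduces the claim to fixed collections.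
  Admissibility at every outcome allows the index set to consist of collections inside
  \<open>[p, q]\<close>, where the observations are measurable.\<close>

lemma measurable_wbs_stat_draw:
  assumes Y: "\<And>i. i \<in> {p..q} \<Longrightarrow> Y i \<in> borel_measurable M"
    and C: "C \<in> measurable M (count_space UNIV)"
      "\<And>\<omega>. \<omega> \<in> space M \<Longrightarrow> C \<omega> \<in> interval_collections p q m"
  shows "(\<lambda>\<omega>. wbs_stat (\<lambda>i. Y i \<omega>) (C \<omega>)) \<in> borel_measurable M"
proof (rule measurable_compose_countable'[where g = C and f = "\<lambda>Fs \<omega>. wbs_stat (\<lambda>i. Y i \<omega>) Fs"])
  show "C \<in> measurable M (count_space (interval_collections p q m))"
    by (rule measurable_count_space_extend[OF subset_UNIV _ C(1)]) (simp add: C(2))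
  fix Fs assume "Fs \<in> interval_collections p q m"
  with Y show "(\<lambda>\<omega>. wbs_stat (\<lambda>i. Y i \<omega>) Fs) \<in> borel_measurable M"
    by (rule measurable_wbs_stat)
qed simp

lemma scheme_drawD:
  assumes "scheme_draw M S m (p, q) C"
  shows "C \<in> measurable M (count_space UNIV)"
    "\<And>\<omega>. \<omega> \<in> space M \<Longrightarrow> C \<omega> \<in> interval_collections p q m"
    "distr M (count_space UNIV) C = measure_pmf (S p q m)"
  using assms by (auto simp: scheme_draw_def)

section \<open>Measurability of maximizers and split points\<close>

lemma measurable_filter:
  fixes xs :: "'b::countable list"
  assumes "\<And>x. x \<in> set xs \<Longrightarrow> Measurable.pred M (P x)"
  shows "(\<lambda>\<omega>. filter (\<lambda>x. P x \<omega>) xs) \<in> measurable M (count_space UNIV)"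
  using assms
proof (induction xs)
  case (Cons x xs)
  have [measurable]: "Measurable.pred M (P x)"
    "(\<lambda>\<omega>. filter (\<lambda>x. P x \<omega>) xs) \<in> measurable M (count_space UNIV)"
    using Cons by auto
  show ?case
    by simp
qed simp

text \<open>With the list of maximizers as a random element of a discrete space, any tie-breaking
  rule applied to it is measurable, since every function out of a \<open>count_space\<close>
  is.\<close>

lemma measurable_maximizers:
  fixes xs :: "'b::countable list"
  assumes [measurable]: "\<And>x. x \<in> set xs \<Longrightarrow> f x \<in> borel_measurable M"
  shows "(\<lambda>\<omega>. maximizers (\<lambda>x. f x \<omega>) xs) \<in> measurable M (count_space UNIV)"
  unfolding maximizers_def
proof (rule measurable_filter)
  fix x assume [measurable]: "x \<in> set xs"
  have "Measurable.pred M (\<lambda>\<omega>. f x' \<omega> \<le> f x \<omega>)" if [measurable]: "x' \<in> set xs" for x'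
    by measurable
  then show "Measurable.pred M (\<lambda>\<omega>. \<forall>x'\<in>set xs. f x' \<omega> \<le> f x \<omega>)"
    by (intro pred_intros_finite) simp_all
qed

lemma maximizers_nonempty:
  assumes "xs \<noteq> []"
  shows "maximizers f xs \<noteq> []"
proof -
  obtain x where "x \<in> set xs" "f x = Max (f ` set xs)"
    using assms Max_in[of "f ` set xs"] by (auto simp: image_iff)
  then have "x \<in> set xs" "\<forall>x'\<in>set xs. f x' \<le> f x"
    by auto
  then show ?thesis
    by (auto simp: maximizers_def filter_empty_conv)
qed

lemma tie_breaker_maximizers:
  assumes "tie_breaker c" "xs \<noteq> []"
  shows "c (maximizers f xs) \<in> set xs"
proof -
  have "c (maximizers f xs) \<in> set (maximizers f xs)"
    using assms maximizers_nonempty unfolding tie_breaker_def by blast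
  then show ?thesis
    by (simp add: maximizers_def)
qed

lemma measurable_split_point:
  assumes Y: "\<And>i. i \<in> {p..q} \<Longrightarrow> Y i \<in> borel_measurable M"
    and Fs: "Fs \<in> interval_collections p q m" and "Fs \<noteq> []" and cI: "tie_breaker cI"
  shows "(\<lambda>\<omega>. split_point cI cK (\<lambda>i. Y i \<omega>) Fs) \<in> measurable M (count_space UNIV)"
proof -
  define J where "J = (\<lambda>\<omega>. cI (maximizers (interval_stat (\<lambda>i. Y i \<omega>)) Fs))"
  from measurable_maximizers[OF measurable_interval_stat[OF Y Fs]]
  have "J \<in> measurable M (count_space UNIV)"
    unfolding J_def by (rule measurable_compose[OF _ measurable_count_space])
  \<comment> \<open>The rule picks from a nonempty list of maximizers and so stays in
    \<open>Fs\<close>. Hence \<open>J\<close> has finitely many values, all of them intervals inside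
    \<open>[p, q]\<close>, and the inner maximization can be treated for each fixed
    interval.\<close>
  then have J: "J \<in> measurable M (count_space (set Fs))"
    by (rule measurable_count_space_extend[OF subset_UNIV, rotated])
      (simp add: J_def tie_breaker_maximizers[OF cI \<open>Fs \<noteq> []\<close>])
  have "(\<lambda>\<omega>. cK (maximizers (lepage (\<lambda>i. Y i \<omega>) (fst I) (snd I)) [fst I..<snd I]))
      \<in> measurable M (count_space UNIV)" if "I \<in> set Fs" for I
  proof -
    have I: "p \<le> fst I" "snd I \<le> q"
      using that interval_collectionsD[OF Fs, of "fst I" "snd I"] by simp_all
    have "(\<lambda>\<omega>. lepage (\<lambda>i. Y i \<omega>) (fst I) (snd I) k) \<in> borel_measurable M"
      if "k \<in> set [fst I..<snd I]" for k
      using that I by (intro measurable_lepage Y) simp_all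
    from measurable_maximizers[OF this] show ?thesis
      by (rule measurable_compose[OF _ measurable_count_space])
  qed
  from measurable_compose_countable'[OF this J countable_finite[OF finite_set]]
  show ?thesis
    unfolding split_point_def J_def case_prod_beta Let_def .
qed

lemma measurable_split_point_draw:
  assumes Y: "\<And>i. i \<in> {p..q} \<Longrightarrow> Y i \<in> borel_measurable M"
    and C: "C \<in> measurable M (count_space UNIV)"
      "\<And>\<omega>. \<omega> \<in> space M \<Longrightarrow> C \<omega> \<in> interval_collections p q m"
    and "1 \<le> m" and cI: "tie_breaker cI"
  shows "(\<lambda>\<omega>. split_point cI cK (\<lambda>i. Y i \<omega>) (C \<omega>)) \<in> measurable M (count_space UNIV)"
proof (rule measurable_compose_countable'[where g = C and f = "\<lambda>Fs \<omega>. split_point cI cK (\<lambda>i. Y i \<omega>) Fs"])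
  show "C \<in> measurable M (count_space (interval_collections p q m))"
    by (rule measurable_count_space_extend[OF subset_UNIV _ C(1)]) (simp add: C(2))
  fix Fs assume Fs: "Fs \<in> interval_collections p q m"
  \<comment> \<open>\<open>1 \<le> m\<close> guarantees an interval from which the rule can
    choose.\<close>
  then have ne: "Fs \<noteq> []"
    using \<open>1 \<le> m\<close> by (auto simp: interval_collections_def)
  from Y Fs ne cI show "(\<lambda>\<omega>. split_point cI cK (\<lambda>i. Y i \<omega>) Fs) \<in> measurable M (count_space UNIV)"
    by (rule measurable_split_point)
qed simp

section \<open>Measurability of the detection event\<close>

lemma wbs_lp_subset: "wbs_lp cI cK \<gamma> y F p q \<subseteq> {p..<q}"
proof (induction "q + 1 - p" arbitrary: p q rule: less_induct)
  case less
  define k where "k = split_point cI cK y (F (p, q))"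
  show ?case
  proof (cases "q + 1 < p + 10 \<or> k \<notin> {p..<q}")
    case True
    then show ?thesis
      by (auto simp: wbs_lp.simps[of _ _ _ _ _ p q] Let_def k_def)
  next
    case False
    then have "wbs_lp cI cK \<gamma> y F p k \<subseteq> {p..<k}" "wbs_lp cI cK \<gamma> y F (k + 1) q \<subseteq> {k + 1..<q}"
      by (auto intro!: less)
    moreover have "wbs_lp cI cK \<gamma> y F p q
        \<subseteq> wbs_lp cI cK \<gamma> y F p k \<union> {k} \<union> wbs_lp cI cK \<gamma> y F (k + 1) q"
      by (subst wbs_lp.simps) (auto simp: Let_def k_def)
    ultimately show ?thesis
      using False by fastforce
  qed
qed

context
  fixes M :: "'a measure" and n m :: nat and Y :: "nat \<Rightarrow> 'a \<Rightarrow> real"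
    and F G :: "interval \<Rightarrow> 'a \<Rightarrow> interval list" and \<gamma> :: "nat \<Rightarrow> 'a \<Rightarrow> real"
    and cI :: "interval list \<Rightarrow> interval" and cK :: "nat list \<Rightarrow> nat"
  assumes Y: "\<And>i. i \<in> {1..n} \<Longrightarrow> Y i \<in> borel_measurable M"
    and \<gamma> [measurable]: "\<And>l. \<gamma> l \<in> borel_measurable M"
    and F: "\<And>p q. (p, q) \<in> segments n \<Longrightarrow> F (p, q) \<in> measurable M (count_space UNIV)"
      "\<And>p q \<omega>. (p, q) \<in> segments n \<Longrightarrow> \<omega> \<in> space M \<Longrightarrow> F (p, q) \<omega> \<in> interval_collections p q m"
    and G: "\<And>p q. (p, q) \<in> segments n \<Longrightarrow> G (p, q) \<in> measurable M (count_space UNIV)"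
      "\<And>p q \<omega>. (p, q) \<in> segments n \<Longrightarrow> \<omega> \<in> space M \<Longrightarrow> G (p, q) \<omega> \<in> interval_collections p q m"
    and cI: "tie_breaker cI" and m: "1 \<le> m"
begin

lemma pred_wbs_lp:
  assumes "1 \<le> p" "q \<le> n"
  shows "Measurable.pred M
    (\<lambda>\<omega>. t \<in> wbs_lp cI cK (\<lambda>l. \<gamma> l \<omega>) (\<lambda>i. Y i \<omega>) (\<lambda>s. F s \<omega>) p q)"
  using assms
proof (induction "q + 1 - p" arbitrary: p q rule: less_induct)
  case less
  let ?W = "\<lambda>\<omega>. wbs_lp cI cK (\<lambda>l. \<gamma> l \<omega>) (\<lambda>i. Y i \<omega>) (\<lambda>s. F s \<omega>)"
  show ?case
  proof (cases "q + 1 < p + 10")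
    case True
    then show ?thesis
      by (simp add: wbs_lp.simps[of _ _ _ _ _ p q])
  next
    case False
    then have pq: "(p, q) \<in> segments n"
      using less.prems by (auto simp: segments_def)
    define K where "K = (\<lambda>\<omega>. split_point cI cK (\<lambda>i. Y i \<omega>) (F (p, q) \<omega>))"
    have [measurable]: "K \<in> measurable M (count_space UNIV)"
      unfolding K_def using less.prems
      by (intro measurable_split_point_draw[OF _ F(1)[OF pq] F(2)[OF pq] m cI] Y) auto
    have [measurable]: "(\<lambda>\<omega>. wbs_stat (\<lambda>i. Y i \<omega>) (F (p, q) \<omega>)) \<in> borel_measurable M"
      using less.prems by (intro measurable_wbs_stat_draw[OF _ F(1)[OF pq] F(2)[OF pq]] Y) auto
    have [measurable]: "Measurable.pred M (\<lambda>\<omega>. t \<in> ?W \<omega> p k)"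
      "Measurable.pred M (\<lambda>\<omega>. t \<in> ?W \<omega> (k + 1) q)" if "k \<in> {p..<q}" for k
      using that less.prems by (auto intro!: less.hyps)
    \<comment> \<open>The recursive calls have a random endpoint, to which the induction hypothesis
      does not apply. A finite union over the values \<open>k\<close> of the split point makes the
      endpoints deterministic.\<close>
    have "t \<in> ?W \<omega> p q \<longleftrightarrow> (\<exists>k\<in>{p..<q}. K \<omega> = k \<and>
        wbs_stat (\<lambda>i. Y i \<omega>) (F (p, q) \<omega>) > \<gamma> (q - p + 1) \<omega> \<and>
        (t \<in> ?W \<omega> p k \<or> t = k \<or> t \<in> ?W \<omega> (k + 1) q))" for \<omega>
      using False by (subst wbs_lp.simps) (auto simp: Let_def K_def)
    moreover have "Measurable.pred M (\<lambda>\<omega>. \<exists>k\<in>{p..<q}. K \<omega> = k \<and>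
        wbs_stat (\<lambda>i. Y i \<omega>) (F (p, q) \<omega>) > \<gamma> (q - p + 1) \<omega> \<and>
        (t \<in> ?W \<omega> p k \<or> t = k \<or> t \<in> ?W \<omega> (k + 1) q))"
      by measurable
    ultimately show ?thesis
      by (simp only:)
  qed
qed

text \<open>The segments tested in pruning depend on the whole candidate set, through the neighbours
  of each candidate. The event is therefore split by the value \<open>c\<close> of that set, one of
  the finitely many subsets of \<open>{1..n}\<close>; for fixed \<open>c\<close> all segments are
  deterministic.\<close>

lemma sets_wbs_lepage_detects:
  "{\<omega> \<in> space M. wbs_lepage cI cK keep (\<lambda>l. \<gamma> l \<omega>) n (\<lambda>i. Y i \<omega>) (\<lambda>s. F s \<omega>) (\<lambda>s. G s \<omega>) \<noteq> {}}
    \<in> sets M"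
proof -
  let ?W = "\<lambda>\<omega>. wbs_lp cI cK (\<lambda>l. \<gamma> l \<omega>) (\<lambda>i. Y i \<omega>) (\<lambda>s. F s \<omega>) 1 n"
  let ?P = "\<lambda>\<omega>. prune keep (\<lambda>l. \<gamma> l \<omega>) n (\<lambda>i. Y i \<omega>) (\<lambda>s. G s \<omega>)"
  have W: "?W \<omega> \<in> Pow {1..n}" for \<omega>
    using wbs_lp_subset[of cI cK "\<lambda>l. \<gamma> l \<omega>" "\<lambda>i. Y i \<omega>" "\<lambda>s. F s \<omega>" 1 n] by fastforce
  have [measurable]: "Measurable.pred M (\<lambda>\<omega>. ?W \<omega> = c)" if "c \<in> Pow {1..n}" for c
  proof -
    have "?W \<omega> = c \<longleftrightarrow> (\<forall>t\<in>{1..n}. t \<in> ?W \<omega> \<longleftrightarrow> t \<in> c)" for \<omega>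
      using W[of \<omega>] that by blast
    moreover have "Measurable.pred M (\<lambda>\<omega>. \<forall>t\<in>{1..n}. t \<in> ?W \<omega> \<longleftrightarrow> t \<in> c)"
      using pred_wbs_lp[OF order_refl order_refl, measurable] by measurable
    ultimately show ?thesis
      by (simp only:)
  qed
  have [measurable]: "Measurable.pred M (\<lambda>\<omega>. ?P \<omega> c \<noteq> {})" if c: "c \<in> Pow {1..n}" for c
  proof -
    have fin: "finite c"
      using c by (auto intro: finite_subset)
    define a b where "a t = Max (insert 0 {u \<in> c. u < t}) + 1"
      and "b t = Min (insert n {u \<in> c. t < u})" for t
    have [measurable]: "Measurable.pred M (\<lambda>\<omega>. if b t + 1 < a t + 10 then keep
        else wbs_stat (\<lambda>i. Y i \<omega>) (G (a t, b t) \<omega>) > \<gamma> (b t - a t + 1) \<omega>)" if "t \<in> c" for t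
    proof (cases "b t + 1 < a t + 10")
      case False
      have "1 \<le> a t" "b t \<le> n"
        unfolding a_def b_def using fin by (auto intro!: Min_le)
      then have ab: "(a t, b t) \<in> segments n"
        using False by (auto simp: segments_def)
      have [measurable]: "(\<lambda>\<omega>. wbs_stat (\<lambda>i. Y i \<omega>) (G (a t, b t) \<omega>)) \<in> borel_measurable M"
        using \<open>1 \<le> a t\<close> \<open>b t \<le> n\<close>
        by (intro measurable_wbs_stat_draw[OF _ G(1)[OF ab] G(2)[OF ab]] Y) auto
      show ?thesis
        using False by simp
    qed simp
    have "?P \<omega> c \<noteq> {} \<longleftrightarrow> (\<exists>t\<in>c. if b t + 1 < a t + 10 then keep
        else wbs_stat (\<lambda>i. Y i \<omega>) (G (a t, b t) \<omega>) > \<gamma> (b t - a t + 1) \<omega>)" for \<omega>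
      by (auto simp: prune_def Let_def a_def b_def)
    moreover have "Measurable.pred M (\<lambda>\<omega>. \<exists>t\<in>c. if b t + 1 < a t + 10 then keep
        else wbs_stat (\<lambda>i. Y i \<omega>) (G (a t, b t) \<omega>) > \<gamma> (b t - a t + 1) \<omega>)"
      using fin by measurable
    ultimately show ?thesis
      by (simp only:)
  qed
  have "Measurable.pred M (\<lambda>\<omega>. \<exists>c\<in>Pow {1..n}. ?W \<omega> = c \<and> ?P \<omega> c \<noteq> {})"
    by measurable
  moreover have "(\<exists>c\<in>Pow {1..n}. ?W \<omega> = c \<and> ?P \<omega> c \<noteq> {}) \<longleftrightarrow> ?P \<omega> (?W \<omega>) \<noteq> {}" for \<omega>
    using W[of \<omega>] by blast
  ultimately show ?thesis
    unfolding pred_def wbs_lepage_def by (simp only:)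
qed

end

text \<open>Pruning only filters, so a surviving candidate requires the outermost call to return
  something. \<open>1 \<le> n\<close> identifies the length \<open>n - 1 + 1\<close> used by that
  call with \<open>n\<close>.\<close>

lemma wbs_lepage_detectsD:
  assumes "wbs_lepage cI cK keep \<gamma> n y F G \<noteq> {}" "1 \<le> n"
  shows "wbs_stat y (F (1, n)) > \<gamma> n"
proof -
  have "wbs_lp cI cK \<gamma> y F 1 n \<noteq> {}"
    using assms by (auto simp: wbs_lepage_def prune_def)
  then show ?thesis
    using \<open>1 \<le> n\<close> by (subst (asm) wbs_lp.simps) (auto simp: Let_def split: if_splits)
qed

section \<open>The null law\<close>

text \<open>The Galois connection between a right-continuous cdf and its generalized inverse. The
  bounds on \<open>u\<close> make the set under the infimum bounded below and nonempty.\<close>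

lemma quantile_le_iff:
  assumes "real_distribution P" "0 < u" "u < 1"
  shows "quantile P u \<le> x \<longleftrightarrow> u \<le> cdf P x"
proof -
  interpret cdf_distribution P
    using assms(1) by (simp add: cdf_distribution_def)
  show ?thesis
    using pseudoinverse[of u x] assms(2,3) by (simp add: quantile_def)
qed

lemma cdf_quantile_ge:
  assumes "real_distribution P" "0 < u" "u < 1"
  shows "u \<le> cdf P (quantile P u)"
  using quantile_le_iff[OF assms, of "quantile P u"] by simp

text \<open>This is where continuity of \<open>D\<close> enters: an atom would make the quantile
  function constant on an interval. Continuity gives \<open>cdf D (quantile D v) = v\<close>, for
  otherwise the cdf would exceed \<open>v\<close> already slightly to the left of the quantile,
  against its minimality. The Galois connection at \<open>u\<close> then finishes.\<close>

lemma quantile_le_quantile_iff: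
  assumes D: "continuous_distribution D" and uv: "0 < u" "u < 1" "0 < v" "v < 1"
  shows "quantile D u \<le> quantile D v \<longleftrightarrow> u \<le> v"
proof -
  have RD: "real_distribution D" and cont: "continuous_on UNIV (cdf D)"
    using D by (auto simp: continuous_distribution_def)
  have "cdf D (quantile D v) = v"
  proof (rule ccontr)
    assume "cdf D (quantile D v) \<noteq> v"
    then have "v < cdf D (quantile D v)"
      using cdf_quantile_ge[OF RD uv(3,4)] by simp
    moreover have "(cdf D \<longlongrightarrow> cdf D (quantile D v)) (at_left (quantile D v))"
      using cont by (simp add: continuous_on_eq_continuous_at isCont_def filterlim_at_split)
    ultimately have "\<forall>\<^sub>F x in at_left (quantile D v). v < cdf D x"
      by (simp add: order_tendstoD)
    moreover have "\<forall>\<^sub>F x in at_left (quantile D v). x < quantile D v"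
      by (simp add: eventually_at_filter)
    ultimately have "\<forall>\<^sub>F x in at_left (quantile D v). v < cdf D x \<and> x < quantile D v"
      by (rule eventually_conj)
    then obtain x where "v < cdf D x" "x < quantile D v"
      using eventually_happens' trivial_limit_at_left_real by blast
    then show False
      using quantile_le_iff[OF RD uv(3,4), of x] by simp
  qed
  then show ?thesis
    using quantile_le_iff[OF RD uv(1,2)] by simp
qed

text \<open>Restricting the space to the open interval, rather than using a law on all reals, puts
  every point in the range where the quantile function is strictly increasing.\<close>

definition unit_uniform :: "real measure" where
  "unit_uniform = restrict_space lborel {0<..<1}"

lemma space_unit_uniform: "space unit_uniform = {0<..<1}"
  by (simp add: unit_uniform_def space_restrict_space)

lemma prob_space_unit_uniform: "prob_space unit_uniform"
  by (rule prob_spaceI) (simp add: unit_uniform_def emeasure_restrict_space space_restrict_space)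

lemma measurable_quantile:
  assumes "real_distribution D"
  shows "quantile D \<in> borel_measurable unit_uniform"
proof -
  interpret cdf_distribution D
    using assms by (simp add: cdf_distribution_def)
  show ?thesis
    using measurable_CI unfolding unit_uniform_def quantile_def
    by (simp cong: measurable_cong_sets add: sets_restrict_space)
qed

lemma distr_unit_uniform_quantile:
  assumes "real_distribution D"
  shows "distr unit_uniform borel (quantile D) = D"
proof -
  interpret cdf_distribution D
    using assms by (simp add: cdf_distribution_def)
  show ?thesis
    using distr_I_eq_M by (simp add: unit_uniform_def quantile_def[abs_def])
qed

section \<open>Product measures and independent families\<close>

lemma distr_PiM_map:
  assumes M: "\<And>i. i \<in> I \<Longrightarrow> prob_space (M i)" and "I \<noteq> {}"
    and h: "\<And>i. i \<in> I \<Longrightarrow> h i \<in> measurable (M i) (N i)"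
  shows "distr (PiM I M) (PiM I N) (\<lambda>z. \<lambda>i\<in>I. h i (z i)) = (\<Pi>\<^sub>M i\<in>I. distr (M i) (N i) (h i))"
proof -
  interpret P: prob_space "PiM I M"
    using M by (rule prob_space_PiM)
  have component: "distr (PiM I M) (M i) (\<lambda>z. z i) = M i" if "i \<in> I" for i
    using M that by (rule distr_PiM_component)
  \<comment> \<open>Coordinates of a product are independent: jointly they form the identity, whose
    law is the product of the marginals. Composing each with \<open>h i\<close> keeps independence,
    which read backwards is again a product law.\<close>
  have "distr (PiM I M) (PiM I M) (\<lambda>z. \<lambda>i\<in>I. z i) = distr (PiM I M) (PiM I M) (\<lambda>z. z)"
    by (rule distr_cong) (auto simp: space_PiM)
  also have "\<dots> = (\<Pi>\<^sub>M i\<in>I. distr (PiM I M) (M i) (\<lambda>z. z i))"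
    by (simp add: component cong: PiM_cong)
  finally have "P.indep_vars M (\<lambda>i z. z i) I"
    using \<open>I \<noteq> {}\<close> by (subst P.indep_vars_iff_distr_eq_PiM') auto
  then have "P.indep_vars N (\<lambda>i. h i \<circ> (\<lambda>z. z i)) I"
    using h by (rule P.indep_vars_compose)
  then have "P.indep_vars N (\<lambda>i z. h i (z i)) I"
    by (simp add: comp_def)
  moreover have "(\<lambda>z. h i (z i)) \<in> measurable (PiM I M) (N i)" if "i \<in> I" for i
    using measurable_component_singleton[OF that] h[OF that] by (rule measurable_compose)
  ultimately have "distr (PiM I M) (PiM I N) (\<lambda>z. \<lambda>i\<in>I. h i (z i))
      = (\<Pi>\<^sub>M i\<in>I. distr (PiM I M) (N i) (\<lambda>z. h i (z i)))"
    using \<open>I \<noteq> {}\<close> by (subst (asm) P.indep_vars_iff_distr_eq_PiM') auto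
  also have "\<dots> = (\<Pi>\<^sub>M i\<in>I. distr (M i) (N i) (h i))"
  proof (intro PiM_cong refl)
    fix i assume i: "i \<in> I"
    have "distr (distr (PiM I M) (M i) (\<lambda>z. z i)) (N i) (h i)
        = distr (PiM I M) (N i) (\<lambda>z. h i (z i))"
      using i h by (subst distr_distr) (auto simp: comp_def)
    then show "distr (PiM I M) (N i) (\<lambda>z. h i (z i)) = distr (M i) (N i) (h i)"
      by (simp add: component i)
  qed
  finally show ?thesis .
qed

text \<open>Arranges selected members of a large independent family as coordinates of one vector.
  Injectivity of \<open>f\<close> keeps a variable from filling two coordinates, which would destroy
  the product form.\<close>

lemma (in prob_space) distr_indep_vars_reindex:
  assumes X: "indep_vars (\<lambda>_. N) X I" and f: "inj_on f J" "f \<in> J \<rightarrow> I" and "J \<noteq> {}"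
  shows "distr M (PiM J (\<lambda>_. N)) (\<lambda>\<omega>. \<lambda>j\<in>J. X (f j) \<omega>) = (\<Pi>\<^sub>M j\<in>J. distr M N (X (f j)))"
proof -
  have rv: "X i \<in> measurable M N" if "i \<in> I" for i
    using X that by (auto simp: indep_vars_def)
  have "I \<noteq> {}"
    using f \<open>J \<noteq> {}\<close> by auto
  then have "distr M (PiM I (\<lambda>_. N)) (\<lambda>\<omega>. \<lambda>i\<in>I. X i \<omega>) = (\<Pi>\<^sub>M i\<in>I. distr M N (X i))"
    using X rv by (subst (asm) indep_vars_iff_distr_eq_PiM') auto
  then have "(\<Pi>\<^sub>M j\<in>J. distr M N (X (f j)))
      = distr (distr M (PiM I (\<lambda>_. N)) (\<lambda>\<omega>. \<lambda>i\<in>I. X i \<omega>)) (\<Pi>\<^sub>M j\<in>J. distr M N (X (f j)))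
          (\<lambda>z. \<lambda>j\<in>J. z (f j))"
    using f rv by (subst distr_PiM_reindex[where M = "\<lambda>i. distr M N (X i)" and K = I, symmetric])
      (auto intro: prob_space_distr)
  also have "\<dots> = distr (distr M (PiM I (\<lambda>_. N)) (\<lambda>\<omega>. \<lambda>i\<in>I. X i \<omega>)) (PiM J (\<lambda>_. N))
      (\<lambda>z. \<lambda>j\<in>J. z (f j))"
    by (intro distr_cong sets_PiM_cong) auto
  also have "\<dots> = distr M (PiM J (\<lambda>_. N)) ((\<lambda>z. \<lambda>j\<in>J. z (f j)) \<circ> (\<lambda>\<omega>. \<lambda>i\<in>I. X i \<omega>))"
    using f rv by (intro distr_distr measurable_restrict measurable_component_singleton) auto
  also have "(\<lambda>z. \<lambda>j\<in>J. z (f j)) \<circ> (\<lambda>\<omega>. \<lambda>i\<in>I. X i \<omega>) = (\<lambda>\<omega>. \<lambda>j\<in>J. X (f j) \<omega>)"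
    using f by (auto simp: fun_eq_iff)
  finally show ?thesis ..
qed

text \<open>Collections are encoded as reals, so that observations and collections form one real-valued
  family, to which \<open>indep_vars\<close> applies.\<close>

definition encode :: "interval list \<Rightarrow> real" where
  "encode Fs = real (to_nat Fs)"

lemma from_nat_encode: "from_nat (nat \<lfloor>encode Fs\<rfloor>) = Fs"
  by (simp add: encode_def)

lemma (in prob_space) indep_vars_sources:
  assumes indep: "indep_sources M Z A K B"
    and Z: "\<And>i. i \<in> A \<Longrightarrow> random_variable borel (Z i)"
    and K: "\<And>j. j \<in> B \<Longrightarrow> random_variable (count_space UNIV) (K j)"
  shows "indep_vars (\<lambda>_. borel) (case_sum Z (\<lambda>j \<omega>. encode (K j \<omega>))) (A <+> B)"
  unfolding indep_vars_def2
proof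
  show "\<forall>i\<in>A <+> B. random_variable borel (case_sum Z (\<lambda>j \<omega>. encode (K j \<omega>)) i)"
    using Z K by (auto intro!: measurable_compose[OF K])
  have "{case_sum Z (\<lambda>j \<omega>. encode (K j \<omega>)) i -` E \<inter> space M |E. E \<in> sets borel}
    \<subseteq> case_sum (\<lambda>i. {Z i -` E \<inter> space M |E. E \<in> sets borel})
        (\<lambda>j. {K j -` E \<inter> space M |E. E \<in> sets (count_space UNIV)}) i" for i
  proof (cases i)
    case (Inr j)
    \<comment> \<open>Coding cannot enlarge the generated sigma-algebra: every event about the code
      is an event about the collection.\<close>
    have "(\<lambda>\<omega>. encode (K j \<omega>)) -` E = K j -` (encode -` E)" for E
      by auto
    then show ?thesis
      by (auto simp: Inr)
  qed simp
  with indep show "indep_sets (\<lambda>i. {case_sum Z (\<lambda>j \<omega>. encode (K j \<omega>)) i -` E \<inter> space M |E. E \<in> sets borel})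
      (A <+> B)"
    unfolding indep_sources_def by (rule indep_sets_mono_sets)
qed

text \<open>Coordinate 0 carries the encoded collection, coordinate \<open>i \<ge> 1\<close> the observation \<open>i\<close>.\<close>

definition coded_stat :: "nat \<Rightarrow> nat \<Rightarrow> (nat \<Rightarrow> real) \<Rightarrow> real" where
  "coded_stat n m z =
     (let Fs = from_nat (nat \<lfloor>z 0\<rfloor>)
      in if Fs \<in> interval_collections 1 n m then wbs_stat z Fs else 0)"

lemma coded_stat_order_cong:
  assumes "y 0 = z 0"
    and "\<And>i j. i \<in> {1..n} \<Longrightarrow> j \<in> {1..n} \<Longrightarrow> y i \<le> y j \<longleftrightarrow> z i \<le> z j"
  shows "coded_stat n m y = coded_stat n m z"
  using wbs_stat_order_cong[of _ 1 n m y z] assms by (simp add: coded_stat_def Let_def)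

lemma coded_stat_eq_wbs_stat:
  assumes "z 0 = encode Fs" "\<And>i. i \<in> {1..n} \<Longrightarrow> z i = y i" "Fs \<in> interval_collections 1 n m"
  shows "coded_stat n m z = wbs_stat y Fs"
  using wbs_stat_order_cong[of Fs 1 n m z y] assms
  by (simp add: coded_stat_def from_nat_encode)

text \<open>A real in coordinate 0 may decode to a collection reaching beyond \<open>n\<close>. The
  default value 0 of \<open>coded_stat\<close> disposes of that case, and the decoded collection is
  countably valued.\<close>

lemma measurable_coded_stat [measurable]:
  "coded_stat n m \<in> borel_measurable (PiM {..n} (\<lambda>_. borel))"
proof -
  let ?M = "PiM {..n} (\<lambda>_. borel :: real measure)"
  define C :: "(nat \<Rightarrow> real) \<Rightarrow> interval list" where "C z = from_nat (nat \<lfloor>z 0\<rfloor>)" for z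
  have C: "C \<in> measurable ?M (count_space UNIV)"
  proof -
    have [measurable]: "(\<lambda>z. z 0) \<in> borel_measurable ?M"
      by (rule measurable_component_singleton) simp
    have "(\<lambda>z. \<lfloor>z 0\<rfloor>) \<in> measurable ?M (count_space UNIV)"
      by measurable
    from measurable_compose[OF this measurable_count_space] show ?thesis
      unfolding C_def .
  qed
  have "(\<lambda>z. if Fs \<in> interval_collections 1 n m then wbs_stat z Fs else 0) \<in> borel_measurable ?M"
    for Fs
  proof (cases "Fs \<in> interval_collections 1 n m")
    case True
    have "(\<lambda>z. z i) \<in> borel_measurable ?M" if "i \<in> {1..n}" for i
      using that by (intro measurable_component_singleton) simp
    from measurable_wbs_stat[OF this True] True show ?thesis
      by simp
  qed simp
  from measurable_compose_countable[OF this C] show ?thesis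
    unfolding coded_stat_def C_def Let_def .
qed

text \<open>The candidate for the common law, built from uniform observations. Its arguments are all
  that the law may depend on; neither a sample space nor a data distribution occurs, so samples
  living on different spaces can be compared through it.\<close>

definition null_law :: "nat \<Rightarrow> nat \<Rightarrow> interval list pmf \<Rightarrow> real measure" where
  "null_law n m p = distr (\<Pi>\<^sub>M i\<in>{..n}. if i = 0 then distr p borel encode else unit_uniform) borel
     (coded_stat n m)"

lemma distr_coded_stat_continuous:
  fixes p :: "interval list pmf"
  assumes D: "continuous_distribution D"
  shows "distr (\<Pi>\<^sub>M i\<in>{..n}. if i = 0 then distr p borel encode else D) borel (coded_stat n m)
    = null_law n m p"
proof -
  have RD: "real_distribution D"
    using D by (simp add: continuous_distribution_def)
  define U where "U i = (if i = 0 then distr p borel encode else unit_uniform)" for i :: nat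
  \<comment> \<open>The code in coordinate 0 must pass unchanged, so that both sides decode the same
    collection.\<close>
  define h where "h i = (if i = 0 then (\<lambda>x. x) else quantile D)" for i :: nat
  have U: "prob_space (U i)" for i
    by (auto simp: U_def prob_space_unit_uniform intro!: measure_pmf.prob_space_distr)
  have h: "h i \<in> borel_measurable (U i)" for i
    by (auto simp: U_def h_def measurable_quantile[OF RD])
  have U_borel: "(\<lambda>x. x) \<in> borel_measurable (U i)" for i
    by (auto simp: U_def unit_uniform_def intro: measurable_restrict_space1)
  have "distr (U i) borel (h i) = (if i = 0 then distr p borel encode else D)" for i
    by (auto simp: U_def h_def distr_unit_uniform_quantile[OF RD] intro: distr_id2)
  then have "(\<Pi>\<^sub>M i\<in>{..n}. if i = 0 then distr p borel encode else D)
      = (\<Pi>\<^sub>M i\<in>{..n}. distr (U i) borel (h i))"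
    by simp
  also have "\<dots> = distr (PiM {..n} U) (PiM {..n} (\<lambda>_. borel)) (\<lambda>z. \<lambda>i\<in>{..n}. h i (z i))"
    using U h by (intro distr_PiM_map[symmetric]) auto
  moreover have h_component: "(\<lambda>z. h i (z i)) \<in> borel_measurable (PiM {..n} U)" if "i \<in> {..n}" for i
    using measurable_component_singleton[OF that] h by (rule measurable_compose)
  ultimately have "distr (\<Pi>\<^sub>M i\<in>{..n}. if i = 0 then distr p borel encode else D) borel (coded_stat n m)
      = distr (PiM {..n} U) borel (coded_stat n m \<circ> (\<lambda>z. \<lambda>i\<in>{..n}. h i (z i)))"
    using h_component by (simp only:) (intro distr_distr measurable_coded_stat measurable_restrict)
  also have "\<dots> = distr (PiM {..n} U) borel (coded_stat n m)"
  proof (intro distr_cong refl)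
    fix z assume "z \<in> space (PiM {..n} U)"
    then have "z i \<in> space (U i)" if "i \<in> {1..n}" for i
      using that by (auto simp: space_PiM PiE_iff)
    then have "0 < z i" "z i < 1" if "i \<in> {1..n}" for i
      using that by (fastforce simp: U_def space_unit_uniform)+
    then show "(coded_stat n m \<circ> (\<lambda>z. \<lambda>i\<in>{..n}. h i (z i))) z = coded_stat n m z"
      unfolding comp_def
      by (intro coded_stat_order_cong) (simp_all add: h_def quantile_le_quantile_iff[OF D])
  qed
  finally show ?thesis
    by (simp add: null_law_def U_def[abs_def])
qed

text \<open>The sample may sit inside a larger independent family: \<open>a\<close> locates the
  observations and \<open>j\<close> the collection. This covers both an isolated sample and the
  first draw of a whole run.\<close>

lemma (in null_data) wbs_law_eq_null_law:
  assumes indep: "indep_sources \<Omega> Z A K B"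
    and Z: "\<And>i. i \<in> A \<Longrightarrow> random_variable borel (Z i)"
    and K: "\<And>j. j \<in> B \<Longrightarrow> random_variable (count_space UNIV) (K j)"
    and Y: "inj_on a {1..n}" "\<And>i. i \<in> {1..n} \<Longrightarrow> a i \<in> A" "\<And>i. i \<in> {1..n} \<Longrightarrow> Z (a i) = Y i"
    and C: "j \<in> B" "scheme_draw \<Omega> S m (1, n) (K j)"
  shows "wbs_law \<Omega> Y (K j) = null_law n m (S 1 n m)"
proof -
  define f where "f i = (if i = 0 then Inr j else Inl (a i))" for i :: nat
  define X where "X = case_sum Z (\<lambda>j \<omega>. encode (K j \<omega>))"
  note C' = scheme_drawD[OF C(2)]
  have X0: "X (f 0) = (\<lambda>\<omega>. encode (K j \<omega>))"
    by (simp add: X_def f_def)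
  have Xi: "X (f i) = Y i" if "i \<in> {1..n}" for i
    using that Y(3) by (simp add: X_def f_def)
  have f: "inj_on f {..n}"
    using inj_onD[OF Y(1)] by (intro inj_onI) (auto simp: f_def split: if_splits)
  have f': "f \<in> {..n} \<rightarrow> A <+> B"
    using Y(2) C(1) by (auto simp: f_def)
  have indep_X: "indep_vars (\<lambda>_. borel) X (A <+> B)"
    unfolding X_def using indep Z K by (rule indep_vars_sources)
  have rv: "random_variable borel (X (f i))" if "i \<in> {..n}" for i
    using indep_X f' that by (auto simp: indep_vars_def)
  have "distr \<Omega> borel (X (f i)) = (if i = 0 then distr (S 1 n m) borel encode else D)"
    if "i \<in> {..n}" for i
  proof (cases "i = 0")
    case True
    have "distr \<Omega> borel (X (f 0)) = distr (distr \<Omega> (count_space UNIV) (K j)) borel encode"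
      using C'(1) by (subst distr_distr) (simp_all add: X0 comp_def)
    then show ?thesis
      by (simp add: True C'(3))
  qed (use that Y_distr Xi in simp)
  then have "(\<Pi>\<^sub>M i\<in>{..n}. if i = 0 then distr (S 1 n m) borel encode else D)
      = (\<Pi>\<^sub>M i\<in>{..n}. distr \<Omega> borel (X (f i)))"
    by (intro PiM_cong) simp_all
  also have "\<dots> = distr \<Omega> (PiM {..n} (\<lambda>_. borel)) (\<lambda>\<omega>. \<lambda>i\<in>{..n}. X (f i) \<omega>)"
    using f f' by (intro distr_indep_vars_reindex[OF indep_X, symmetric]) auto
  finally have "null_law n m (S 1 n m)
      = distr (distr \<Omega> (PiM {..n} (\<lambda>_. borel)) (\<lambda>\<omega>. \<lambda>i\<in>{..n}. X (f i) \<omega>)) borel (coded_stat n m)"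
    using distr_coded_stat_continuous[OF continuous_D, of n "S 1 n m" m] by (simp only:)
  also have "\<dots> = distr \<Omega> borel (coded_stat n m \<circ> (\<lambda>\<omega>. \<lambda>i\<in>{..n}. X (f i) \<omega>))"
    by (intro distr_distr measurable_coded_stat measurable_restrict rv)
  also have "\<dots> = wbs_law \<Omega> Y (K j)"
    unfolding wbs_law_def
  proof (intro distr_cong refl)
    fix \<omega> assume "\<omega> \<in> space \<Omega>"
    then show "(coded_stat n m \<circ> (\<lambda>\<omega>. \<lambda>i\<in>{..n}. X (f i) \<omega>)) \<omega> = wbs_stat (\<lambda>i. Y i \<omega>) (K j \<omega>)"
      unfolding comp_def using C'(2) by (intro coded_stat_eq_wbs_stat) (simp_all add: X0 Xi)
  qed
  finally show ?thesis ..
qed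

section \<open>Thresholds\<close>

text \<open>An empirical quantile is the \<open>quantile\<close> of the image under \<open>t\<close>
  of the uniform law on \<open>{..<N}\<close>, so the Galois connection carries over.\<close>

lemma empirical_quantile_le_iff:
  assumes N: "0 < N" and u: "0 < u" "u < 1"
  shows "empirical_quantile N t u \<le> x \<longleftrightarrow> u \<le> real (card {r. r < N \<and> t r \<le> x}) / real N"
proof -
  define P where "P = distr (measure_pmf (pmf_of_set {..<N})) borel t"
  have P: "real_distribution P"
    unfolding P_def by (rule prob_space.real_distribution_distr[OF prob_space_measure_pmf]) simp
  have cdf: "cdf P y = real (card {r. r < N \<and> t r \<le> y}) / real N" for y
  proof -
    have "cdf P y = measure_pmf.prob (pmf_of_set {..<N}) (t -` {..y})"
      by (simp add: cdf_def P_def measure_distr)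
    also have "\<dots> = real (card ({..<N} \<inter> t -` {..y})) / real (card {..<N})"
      using N by (intro measure_pmf_of_set) auto
    also have "{..<N} \<inter> t -` {..y} = {r. r < N \<and> t r \<le> y}"
      by auto
    finally show ?thesis
      by simp
  qed
  have "empirical_quantile N t u = quantile P u"
    by (simp add: empirical_quantile_def quantile_def cdf)
  then show ?thesis
    using quantile_le_iff[OF P u, of x] by (simp add: cdf)
qed

text \<open>By the Galois connection, lying below \<open>c\<close> means that enough of the
  \<open>t r\<close> lie below \<open>c\<close>, a condition on a finite sum of measurable
  indicators.\<close>

lemma measurable_empirical_quantile:
  assumes N: "0 < N" and u: "0 < u" "u < 1"
    and t: "\<And>r. r < N \<Longrightarrow> t r \<in> borel_measurable M"
  shows "(\<lambda>\<omega>. empirical_quantile N (\<lambda>r. t r \<omega>) u) \<in> borel_measurable M"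
proof -
  have "{\<omega> \<in> space M. empirical_quantile N (\<lambda>r. t r \<omega>) u \<le> c} \<in> sets M" for c
  proof -
    have "(\<lambda>\<omega>. of_bool (t r \<omega> \<le> c) :: real) \<in> borel_measurable M" if "r \<in> {..<N}" for r
    proof -
      have [measurable]: "t r \<in> borel_measurable M"
        using t that by simp
      show ?thesis
        by measurable
    qed
    then have [measurable]: "(\<lambda>\<omega>. (\<Sum>r<N. of_bool (t r \<omega> \<le> c)) :: real) \<in> borel_measurable M"
      by (rule borel_measurable_sum)
    have "real (card {r. r < N \<and> t r \<omega> \<le> c}) = (\<Sum>r<N. of_bool (t r \<omega> \<le> c))" for \<omega>
      by (simp add: sum.If_cases of_bool_def Int_def)
    then have "{\<omega> \<in> space M. empirical_quantile N (\<lambda>r. t r \<omega>) u \<le> c}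
        = {\<omega> \<in> space M. u \<le> (\<Sum>r<N. of_bool (t r \<omega> \<le> c)) / real N}"
      by (simp add: empirical_quantile_le_iff[OF N u])
    also have "\<dots> \<in> sets M"
      by measurable
    finally show ?thesis .
  qed
  then show ?thesis
    by (simp add: borel_measurable_iff_le)
qed

text \<open>Coded and original variables are known to agree only on the sample space, where draws
  are admissible.\<close>

lemma (in prob_space) indep_var_cong:
  assumes "\<And>\<omega>. \<omega> \<in> space M \<Longrightarrow> X \<omega> = X' \<omega>" "\<And>\<omega>. \<omega> \<in> space M \<Longrightarrow> Y \<omega> = Y' \<omega>"
  shows "indep_var S X T Y \<longleftrightarrow> indep_var S X' T Y'"
proof -
  have "distr M S X = distr M S X'" "distr M T Y = distr M T Y'"
    "distr M (S \<Otimes>\<^sub>M T) (\<lambda>\<omega>. (X \<omega>, Y \<omega>)) = distr M (S \<Otimes>\<^sub>M T) (\<lambda>\<omega>. (X' \<omega>, Y' \<omega>))"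
    using assms by (auto intro!: distr_cong)
  moreover have "random_variable S X \<longleftrightarrow> random_variable S X'" "random_variable T Y \<longleftrightarrow> random_variable T Y'"
    using assms by (auto intro!: measurable_cong)
  ultimately show ?thesis
    by (simp add: indep_var_distribution_eq)
qed

text \<open>Independence makes the joint law of \<open>g\<close> and \<open>T\<close> a product, so
  Tonelli applies: the section at \<open>x\<close> of the set of pairs with second entry above the
  first is the ray \<open>{x<..}\<close>.\<close>

lemma (in prob_space) prob_greater_indep_var:
  fixes T g :: "'a \<Rightarrow> real"
  assumes indep: "indep_var borel g borel T"
  shows "prob {\<omega> \<in> space M. T \<omega> > g \<omega>} = (\<integral>\<omega>. 1 - cdf (distr M borel T) (g \<omega>) \<partial>M)"
proof -
  have [measurable]: "random_variable borel g" "random_variable borel T"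
    using indep indep_var_rv1 indep_var_rv2 by blast+
  let ?P = "distr M borel T"
  interpret P: cdf_distribution ?P
    by (simp add: cdf_distribution_def)
  have gr: "measure ?P {x<..} = 1 - cdf ?P x" for x
  proof -
    have "{x<..} = space ?P - {..x}"
      by auto
    then show ?thesis
      unfolding cdf_def by (simp only:) (rule P.prob_compl, simp)
  qed
  let ?E = "{z \<in> space (borel \<Otimes>\<^sub>M borel). snd z > (fst z :: real)} :: (real \<times> real) set"
  have E: "?E \<in> sets (borel \<Otimes>\<^sub>M borel)"
    by measurable
  have "emeasure M {\<omega> \<in> space M. T \<omega> > g \<omega>}
      = emeasure (distr M (borel \<Otimes>\<^sub>M borel) (\<lambda>\<omega>. (g \<omega>, T \<omega>))) ?E"
    using E by (subst emeasure_distr) (auto intro!: arg_cong[where f = "emeasure M"] simp: space_pair_measure)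
  also have "distr M (borel \<Otimes>\<^sub>M borel) (\<lambda>\<omega>. (g \<omega>, T \<omega>)) = distr M borel g \<Otimes>\<^sub>M ?P"
    using indep by (simp add: indep_var_distribution_eq)
  also have "emeasure (distr M borel g \<Otimes>\<^sub>M ?P) ?E = (\<integral>\<^sup>+x. emeasure ?P (Pair x -` ?E) \<partial>distr M borel g)"
    using E by (intro P.emeasure_pair_measure_alt) simp
  also have "\<dots> = (\<integral>\<^sup>+x. ennreal (1 - cdf ?P x) \<partial>distr M borel g)"
  proof (intro nn_integral_cong)
    fix x :: real
    have "Pair x -` ?E = {x<..}"
      by (auto simp: space_pair_measure)
    then show "emeasure ?P (Pair x -` ?E) = ennreal (1 - cdf ?P x)"
      by (simp only: P.emeasure_eq_measure gr)
  qed
  also have "\<dots> = (\<integral>\<^sup>+\<omega>. ennreal (1 - cdf ?P (g \<omega>)) \<partial>M)"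
    by (intro nn_integral_distr) simp_all
  finally have "emeasure M {\<omega> \<in> space M. T \<omega> > g \<omega>} = (\<integral>\<^sup>+\<omega>. ennreal (1 - cdf ?P (g \<omega>)) \<partial>M)" .
  then show ?thesis
    unfolding measure_def
    by (subst integral_eq_nn_integral) (simp_all add: P.cdf_bounded_prob)
qed

text \<open>The hypothesis on \<open>c\<close> says that \<open>1 - cdf\<close> at \<open>c\<close>
  is at most \<alpha>. Moving from \<open>c\<close> to \<open>g \<omega>\<close> costs at most the
  absolute cdf difference, and integrating this cost gives \<open>threshold_error\<close>.\<close>

lemma (in prob_space) prob_greater_random_threshold:
  fixes T g :: "'a \<Rightarrow> real"
  assumes indep: "indep_var borel g borel T"
    and c: "1 - \<alpha> \<le> cdf (distr M borel T) c"
  shows "prob {\<omega> \<in> space M. T \<omega> > g \<omega>} \<le> \<alpha> + threshold_error M (distr M borel T) g c"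
proof -
  have [measurable]: "random_variable borel g" "random_variable borel T"
    using indep indep_var_rv1 indep_var_rv2 by blast+
  let ?P = "distr M borel T"
  interpret P: cdf_distribution ?P
    by (simp add: cdf_distribution_def)
  have cdf: "0 \<le> cdf ?P x" "cdf ?P x \<le> 1" for x
    by (simp_all add: P.cdf_nonneg P.cdf_bounded_prob)
  have "\<bar>cdf ?P x - cdf ?P y\<bar> \<le> 1" for x y
    using cdf[of x] cdf[of y] by simp
  then have int: "integrable M (\<lambda>\<omega>. \<bar>cdf ?P (g \<omega>) - cdf ?P c\<bar>)"
    by (intro integrable_const_bound[where B = 1]) auto
  have "prob {\<omega> \<in> space M. T \<omega> > g \<omega>} = (\<integral>\<omega>. 1 - cdf ?P (g \<omega>) \<partial>M)"
    using indep by (rule prob_greater_indep_var)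
  also have "\<dots> \<le> (\<integral>\<omega>. \<alpha> + \<bar>cdf ?P (g \<omega>) - cdf ?P c\<bar> \<partial>M)"
  proof (intro integral_mono)
    show "integrable M (\<lambda>\<omega>. 1 - cdf ?P (g \<omega>))"
      using cdf by (intro integrable_const_bound[where B = 1]) auto
    show "1 - cdf ?P (g \<omega>) \<le> \<alpha> + \<bar>cdf ?P (g \<omega>) - cdf ?P c\<bar>" for \<omega>
      using c by simp
  qed (use int in simp)
  also have "\<dots> = \<alpha> + threshold_error M ?P g c"
    using int by (simp add: threshold_error_def prob_space)
  finally show ?thesis .
qed

section \<open>Null samples, runs and Monte Carlo replications\<close>

lemma (in null_sample) measurable_stat:
  "random_variable borel (\<lambda>\<omega>. wbs_stat (\<lambda>i. Y i \<omega>) (C \<omega>))"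
  using measurable_wbs_stat_draw[OF Y_rv scheme_drawD(1,2)[OF C_draw]] by simp

lemma (in null_sample) wbs_law_eq: "wbs_law \<Omega> Y C = null_law n m (S 1 n m)"
  by (rule wbs_law_eq_null_law[OF indep, where a = "\<lambda>i. i"])
    (use Y_rv C_draw scheme_drawD(1)[OF C_draw] in auto)

lemma (in null_run) initial_segment:
  assumes "10 \<le> n"
  shows "(1, n) \<in> segments n"
  using assms by (simp add: segments_def)

lemma (in null_run) measurable_draw:
  assumes "j \<in> segments n <+> segments n"
  shows "random_variable (count_space UNIV) (case_sum F G j)"
  using assms scheme_drawD(1)[OF F_draw] scheme_drawD(1)[OF G_draw] by auto

lemma (in null_run) wbs_law_eq:
  assumes "10 \<le> n"
  shows "wbs_law \<Omega> Y (F (1, n)) = null_law n m (S 1 n m)"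
  using wbs_law_eq_null_law[OF indep Y_rv measurable_draw, where a = "\<lambda>i. i" and j = "Inl (1, n)"]
    F_draw[OF initial_segment] initial_segment assms by auto

lemma (in null_run) measurable_initial_stat:
  assumes "10 \<le> n"
  shows "random_variable borel (\<lambda>\<omega>. wbs_stat (\<lambda>i. Y i \<omega>) (F (1, n) \<omega>))"
  using measurable_wbs_stat_draw[OF Y_rv scheme_drawD(1,2)[OF F_draw[OF initial_segment[OF assms]]]]
  by simp

text \<open>Thresholds may depend on the outcome, so that the exact threshold (as a constant
  function) and the Monte Carlo threshold are treated together.\<close>

lemma (in null_run) detection:
  fixes cK :: "nat list \<Rightarrow> nat" and keep :: bool
  assumes n: "10 \<le> n" and m: "1 \<le> m" and cI: "tie_breaker cI"
    and \<gamma>: "\<And>l. \<gamma> l \<in> borel_measurable \<Omega>"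
  defines "detection \<equiv> {\<omega> \<in> space \<Omega>.
    wbs_lepage cI cK keep (\<lambda>l. \<gamma> l \<omega>) n (\<lambda>i. Y i \<omega>) (\<lambda>s. F s \<omega>) (\<lambda>s. G s \<omega>) \<noteq> {}}"
  shows "detection \<in> events"
    and "prob detection \<le> prob {\<omega> \<in> space \<Omega>. wbs_stat (\<lambda>i. Y i \<omega>) (F (1, n) \<omega>) > \<gamma> n \<omega>}"
proof -
  show "detection \<in> events"
    unfolding detection_def
    by (rule sets_wbs_lepage_detects[OF Y_rv \<gamma> scheme_drawD(1,2)[OF F_draw]
      scheme_drawD(1,2)[OF G_draw] cI m])
  have [measurable]: "\<gamma> n \<in> borel_measurable \<Omega>"
    "random_variable borel (\<lambda>\<omega>. wbs_stat (\<lambda>i. Y i \<omega>) (F (1, n) \<omega>))"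
    using \<gamma> measurable_initial_stat[OF n] by auto
  show "prob detection \<le> prob {\<omega> \<in> space \<Omega>. wbs_stat (\<lambda>i. Y i \<omega>) (F (1, n) \<omega>) > \<gamma> n \<omega>}"
  proof (rule finite_measure_mono)
    show "detection \<subseteq> {\<omega> \<in> space \<Omega>. wbs_stat (\<lambda>i. Y i \<omega>) (F (1, n) \<omega>) > \<gamma> n \<omega>}"
      unfolding detection_def using wbs_lepage_detectsD n by fastforce
  qed measurable
qed

lemma (in prob_space) prob_greater_constant:
  fixes T :: "'a \<Rightarrow> real"
  assumes T [measurable]: "random_variable borel T" and c: "1 - \<alpha> \<le> cdf (distr M borel T) c"
  shows "prob {\<omega> \<in> space M. T \<omega> > c} \<le> \<alpha>"
proof -
  have "{\<omega> \<in> space M. T \<omega> > c} = space M - T -` {..c} \<inter> space M"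
    by auto
  then have "prob {\<omega> \<in> space M. T \<omega> > c} = 1 - cdf (distr M borel T) c"
    by (simp add: prob_compl cdf_def measure_distr)
  with c show ?thesis
    by simp
qed

text \<open>Threshold and first test statistic are functions of disjoint blocks of one independent
  family: the replications read \<open>X\<close> and \<open>H\<close>, the test reads
  \<open>Y\<close> and the draw on \<open>[1, n]\<close>.\<close>

lemma (in monte_carlo_run) indep_var_monte_carlo_threshold:
  assumes n: "10 \<le> n" and \<alpha>: "0 < \<alpha>" "\<alpha> < 1"
  shows "indep_var borel (monte_carlo_threshold \<alpha> N X H)
    borel (\<lambda>\<omega>. wbs_stat (\<lambda>i. Y i \<omega>) (F (1, n) \<omega>))"
proof -
  define K where "K = case_sum (case_sum F G) H"
  define W where "W = case_sum (case_sum Y X) (\<lambda>j \<omega>. encode (K j \<omega>))"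
  define A where "A = {1..n} <+> {..<N} \<times> {1..n}"
  define B where "B = (segments n <+> segments n) <+> {..<N}"
  \<comment> \<open>\<open>d i\<close> and \<open>e r i\<close> name the source that fills
    coordinate \<open>i\<close> of \<open>coded_stat\<close>, for the data and for replication
    \<open>r\<close> respectively. Their ranges are the two blocks.\<close>
  define d :: "nat \<Rightarrow> (nat + nat \<times> nat) + (interval + interval) + nat"
    where "d i = (if i = 0 then Inr (Inl (Inl (1, n))) else Inl (Inl i))" for i
  define e :: "nat \<Rightarrow> nat \<Rightarrow> (nat + nat \<times> nat) + (interval + interval) + nat"
    where "e r i = (if i = 0 then Inr (Inr r) else Inl (Inr (r, i)))" for r i
  define I\<^sub>d where "I\<^sub>d = d ` {..n}"
  define I\<^sub>e where "I\<^sub>e = (\<Union>r<N. e r ` {..n})"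
  note F' = scheme_drawD[OF F_draw[OF initial_segment[OF n]]]
  note H' = scheme_drawD[OF H_draw]
  have X_rv: "random_variable borel (X (r, i))" if "r < N" "i \<in> {1..n}" for r i
    using null_data.Y_rv[OF X_data[OF that(1)] that(2)] .
  have "indep_vars (\<lambda>_. borel) W (A <+> B)"
    unfolding W_def
  proof (rule indep_vars_sources)
    show "indep_sources \<Omega> (case_sum Y X) A K B"
      using joint_indep by (simp add: A_def B_def K_def)
    show "random_variable borel (case_sum Y X i)" if "i \<in> A" for i
      using that Y_rv X_rv by (auto simp: A_def)
    show "random_variable (count_space UNIV) (K j)" if "j \<in> B" for j
      using that scheme_drawD(1)[OF F_draw] scheme_drawD(1)[OF G_draw] H'(1)
      by (auto simp: B_def K_def)
  qed
  moreover have "I\<^sub>e \<inter> I\<^sub>d = {}"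
    by (auto simp: I\<^sub>d_def I\<^sub>e_def d_def e_def split: if_splits)
  moreover have "I\<^sub>e \<subseteq> A <+> B"
    by (auto simp: I\<^sub>e_def e_def A_def B_def split: if_splits)
  moreover have "I\<^sub>d \<subseteq> A <+> B"
    using initial_segment[OF n] by (auto simp: I\<^sub>d_def d_def A_def B_def split: if_splits)
  ultimately have indep: "indep_var (PiM I\<^sub>e (\<lambda>_. borel)) (\<lambda>\<omega>. \<lambda>i\<in>I\<^sub>e. W i \<omega>)
      (PiM I\<^sub>d (\<lambda>_. borel)) (\<lambda>\<omega>. \<lambda>i\<in>I\<^sub>d. W i \<omega>)"
    by (rule indep_var_restrict)
  \<comment> \<open>\<open>g\<close> and \<open>t\<close> recompute the two variables from the
    coordinates of their own block alone, which is the form in which independence of the blocks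
    transfers.\<close>
  define g where "g z = empirical_quantile N (\<lambda>r. coded_stat n m (\<lambda>i\<in>{..n}. z (e r i))) (1 - \<alpha>)" for z
  define t where "t z = coded_stat n m (\<lambda>i\<in>{..n}. z (d i))" for z
  have g: "g \<in> borel_measurable (PiM I\<^sub>e (\<lambda>_. borel))"
    unfolding g_def using N_pos \<alpha>
    by (intro measurable_empirical_quantile measurable_compose[OF _ measurable_coded_stat]
        measurable_restrict measurable_component_singleton) (auto simp: I\<^sub>e_def)
  have t: "t \<in> borel_measurable (PiM I\<^sub>d (\<lambda>_. borel))"
    unfolding t_def
    by (intro measurable_compose[OF _ measurable_coded_stat]
        measurable_restrict measurable_component_singleton) (auto simp: I\<^sub>d_def)
  have "g (\<lambda>i\<in>I\<^sub>e. W i \<omega>) = monte_carlo_threshold \<alpha> N X H \<omega>" if "\<omega> \<in> space \<Omega>" for \<omega>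
  proof -
    have "coded_stat n m (\<lambda>i\<in>{..n}. (\<lambda>i\<in>I\<^sub>e. W i \<omega>) (e r i)) = wbs_stat (\<lambda>i. X (r, i) \<omega>) (H r \<omega>)"
      if r: "r < N" for r
    proof -
      have "e r i \<in> I\<^sub>e" if "i \<le> n" for i
        using r that by (auto simp: I\<^sub>e_def)
      moreover have "W (e r 0) \<omega> = encode (H r \<omega>)" "i \<in> {1..n} \<Longrightarrow> W (e r i) \<omega> = X (r, i) \<omega>" for i
        by (simp_all add: e_def W_def K_def)
      ultimately show ?thesis
        using H'(2)[OF r \<open>\<omega> \<in> space \<Omega>\<close>] by (intro coded_stat_eq_wbs_stat) simp_all
    qed
    then show ?thesis
      by (simp add: g_def monte_carlo_threshold_def empirical_quantile_def cong: conj_cong)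
  qed
  moreover have "t (\<lambda>i\<in>I\<^sub>d. W i \<omega>) = wbs_stat (\<lambda>i. Y i \<omega>) (F (1, n) \<omega>)" if "\<omega> \<in> space \<Omega>" for \<omega>
  proof -
    have "d i \<in> I\<^sub>d" if "i \<le> n" for i
      using that by (auto simp: I\<^sub>d_def)
    moreover have "W (d 0) \<omega> = encode (F (1, n) \<omega>)" "i \<in> {1..n} \<Longrightarrow> W (d i) \<omega> = Y i \<omega>" for i
      by (simp_all add: d_def W_def K_def)
    ultimately show ?thesis
      using F'(2)[OF that] unfolding t_def by (intro coded_stat_eq_wbs_stat) simp_all
  qed
  moreover have "indep_var borel (\<lambda>\<omega>. g (\<lambda>i\<in>I\<^sub>e. W i \<omega>)) borel (\<lambda>\<omega>. t (\<lambda>i\<in>I\<^sub>d. W i \<omega>))"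
    using indep_var_compose[OF indep g t] by (simp add: comp_def)
  ultimately show ?thesis
    by (subst (asm) indep_var_cong) auto
qed

theorem proposition1:
  fixes \<Omega>\<^sub>0 :: "'b measure" and D\<^sub>0 :: "real measure" and Y\<^sub>0 :: "nat \<Rightarrow> 'b \<Rightarrow> real"
    and C\<^sub>0 :: "'b \<Rightarrow> interval list"
    and S :: "nat \<Rightarrow> nat \<Rightarrow> nat \<Rightarrow> interval list pmf"
    and n m :: nat and \<alpha> \<gamma>\<^sub>\<alpha> :: real
    and cI :: "interval list \<Rightarrow> interval" and cK :: "nat list \<Rightarrow> nat" and keep :: bool
  assumes n: "10 \<le> n" and m: "1 \<le> m"
    and S: "interval_scheme S"
    and \<alpha>: "0 < \<alpha>" "\<alpha> < 1"
    and ties: "tie_breaker cI" "tie_breaker cK"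
    and null: "null_sample \<Omega>\<^sub>0 D\<^sub>0 n Y\<^sub>0 S m C\<^sub>0"
    and \<gamma>\<^sub>\<alpha>: "\<gamma>\<^sub>\<alpha> = quantile (wbs_law \<Omega>\<^sub>0 Y\<^sub>0 C\<^sub>0) (1 - \<alpha>)"
  shows
    "(\<forall>(\<Omega> :: 'a measure) D Y C. null_sample \<Omega> D n Y S m C \<longrightarrow>
       wbs_law \<Omega> Y C = wbs_law \<Omega>\<^sub>0 Y\<^sub>0 C\<^sub>0) \<and>
     (\<forall>(\<Omega> :: 'a measure) D Y C. null_sample \<Omega> D n Y S m C \<longrightarrow>
       {\<omega> \<in> space \<Omega>. wbs_stat (\<lambda>i. Y i \<omega>) (C \<omega>) > \<gamma>\<^sub>\<alpha>} \<in> sets \<Omega> \<and>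
       measure \<Omega> {\<omega> \<in> space \<Omega>. wbs_stat (\<lambda>i. Y i \<omega>) (C \<omega>) > \<gamma>\<^sub>\<alpha>} \<le> \<alpha>) \<and>
     (\<forall>(\<Omega> :: 'a measure) D Y F G \<gamma>.
       null_run \<Omega> D n Y S m F G \<and> \<gamma> n = \<gamma>\<^sub>\<alpha> \<longrightarrow>
       (let detection = {\<omega> \<in> space \<Omega>.
          wbs_lepage cI cK keep \<gamma> n (\<lambda>i. Y i \<omega>) (\<lambda>s. F s \<omega>) (\<lambda>s. G s \<omega>) \<noteq> {}}
        in detection \<in> sets \<Omega> \<and> measure \<Omega> detection \<le> \<alpha>)) \<and>
     (\<forall>(\<Omega> :: 'a measure) D Y F G D\<^sub>s N X H \<gamma>.
       monte_carlo_run \<Omega> D n Y S m F G D\<^sub>s N X H \<and>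
       (\<forall>l. \<gamma> l \<in> borel_measurable \<Omega>) \<and>
       (\<forall>\<omega>\<in>space \<Omega>. \<gamma> n \<omega> = monte_carlo_threshold \<alpha> N X H \<omega>) \<longrightarrow>
       (let detection = {\<omega> \<in> space \<Omega>.
          wbs_lepage cI cK keep (\<lambda>l. \<gamma> l \<omega>) n (\<lambda>i. Y i \<omega>) (\<lambda>s. F s \<omega>) (\<lambda>s. G s \<omega>) \<noteq> {}}
        in detection \<in> sets \<Omega> \<and>
           measure \<Omega> detection \<le> \<alpha> +
             threshold_error \<Omega> (wbs_law \<Omega>\<^sub>0 Y\<^sub>0 C\<^sub>0) (monte_carlo_threshold \<alpha> N X H) \<gamma>\<^sub>\<alpha>))"
proof -
  interpret null: null_sample \<Omega>\<^sub>0 D\<^sub>0 n Y\<^sub>0 S m C\<^sub>0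
    by (rule null)
  define P where "P = null_law n m (S 1 n m)"
  have P: "wbs_law \<Omega>\<^sub>0 Y\<^sub>0 C\<^sub>0 = P"
    using null.wbs_law_eq by (simp add: P_def)
  have "real_distribution P"
    using null.measurable_stat by (simp flip: P add: wbs_law_def)
  \<comment> \<open>The null law is concentrated on finitely many values, so equality can fail here;
    the lower bound on the cdf is all that the level-\<alpha> claims use.\<close>
  then have c: "1 - \<alpha> \<le> cdf P \<gamma>\<^sub>\<alpha>"
    unfolding \<gamma>\<^sub>\<alpha> P using \<alpha> by (intro cdf_quantile_ge) auto
  show ?thesis
    unfolding P Let_def
  proof (intro conjI allI impI)
    fix \<Omega> :: "'a measure" and D Y C
    assume "null_sample \<Omega> D n Y S m C"
    then interpret s: null_sample \<Omega> D n Y S m C .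
    have [measurable]: "s.random_variable borel (\<lambda>\<omega>. wbs_stat (\<lambda>i. Y i \<omega>) (C \<omega>))"
      by (rule s.measurable_stat)
    show law: "wbs_law \<Omega> Y C = P"
      by (simp add: s.wbs_law_eq P_def)
    show "{\<omega> \<in> space \<Omega>. wbs_stat (\<lambda>i. Y i \<omega>) (C \<omega>) > \<gamma>\<^sub>\<alpha>} \<in> sets \<Omega>"
      by measurable
    show "measure \<Omega> {\<omega> \<in> space \<Omega>. wbs_stat (\<lambda>i. Y i \<omega>) (C \<omega>) > \<gamma>\<^sub>\<alpha>} \<le> \<alpha>"
      using law c by (intro s.prob_greater_constant) (simp_all add: wbs_law_def)
  next
    fix \<Omega> :: "'a measure" and D Y F G \<gamma>
    assume run: "null_run \<Omega> D n Y S m F G \<and> \<gamma> n = \<gamma>\<^sub>\<alpha>"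
    then interpret r: null_run \<Omega> D n Y S m F G
      by simp
    let ?detection = "{\<omega> \<in> space \<Omega>. wbs_lepage cI cK keep \<gamma> n (\<lambda>i. Y i \<omega>) (\<lambda>s. F s \<omega>) (\<lambda>s. G s \<omega>) \<noteq> {}}"
    note detection = r.detection[OF n m ties(1), where \<gamma> = "\<lambda>l _. \<gamma> l", OF borel_measurable_const]
    show "?detection \<in> sets \<Omega>"
      by (rule detection(1))
    have "measure \<Omega> {\<omega> \<in> space \<Omega>. wbs_stat (\<lambda>i. Y i \<omega>) (F (1, n) \<omega>) > \<gamma>\<^sub>\<alpha>} \<le> \<alpha>"
      using r.wbs_law_eq[OF n] r.measurable_initial_stat[OF n] c
      by (intro r.prob_greater_constant) (simp_all add: wbs_law_def P_def)
    then show "measure \<Omega> ?detection \<le> \<alpha>"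
      using detection(2)[of cK keep] run by simp
  next
    fix \<Omega> :: "'a measure" and D Y F G D\<^sub>s N X H \<gamma>
    assume run: "monte_carlo_run \<Omega> D n Y S m F G D\<^sub>s N X H \<and>
       (\<forall>l. \<gamma> l \<in> borel_measurable \<Omega>) \<and>
       (\<forall>\<omega>\<in>space \<Omega>. \<gamma> n \<omega> = monte_carlo_threshold \<alpha> N X H \<omega>)"
    then interpret r: monte_carlo_run \<Omega> D n Y S m F G D\<^sub>s N X H
      by simp
    let ?detection = "{\<omega> \<in> space \<Omega>.
      wbs_lepage cI cK keep (\<lambda>l. \<gamma> l \<omega>) n (\<lambda>i. Y i \<omega>) (\<lambda>s. F s \<omega>) (\<lambda>s. G s \<omega>) \<noteq> {}}"
    let ?g = "monte_carlo_threshold \<alpha> N X H"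
    have \<gamma>: "\<gamma> l \<in> borel_measurable \<Omega>" for l
      using run by simp
    note detection = r.detection[OF n m ties(1), where \<gamma> = \<gamma>, OF \<gamma>]
    show "?detection \<in> sets \<Omega>"
      by (rule detection(1))
    have "measure \<Omega> ?detection
        \<le> measure \<Omega> {\<omega> \<in> space \<Omega>. wbs_stat (\<lambda>i. Y i \<omega>) (F (1, n) \<omega>) > \<gamma> n \<omega>}"
      by (rule detection(2))
    also have "{\<omega> \<in> space \<Omega>. wbs_stat (\<lambda>i. Y i \<omega>) (F (1, n) \<omega>) > \<gamma> n \<omega>}
        = {\<omega> \<in> space \<Omega>. wbs_stat (\<lambda>i. Y i \<omega>) (F (1, n) \<omega>) > ?g \<omega>}"
      using run by auto
    also have "measure \<Omega> \<dots> \<le> \<alpha> + threshold_error \<Omega> P ?g \<gamma>\<^sub>\<alpha>"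
      using r.prob_greater_random_threshold[OF r.indep_var_monte_carlo_threshold[OF n \<alpha>], of \<alpha> \<gamma>\<^sub>\<alpha>]
        r.wbs_law_eq[OF n] c by (simp add: wbs_law_def P_def)
    finally show "measure \<Omega> ?detection \<le> \<alpha> + threshold_error \<Omega> P ?g \<gamma>\<^sub>\<alpha>" .
  qed
qed

end
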